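(* Let $k=\mathbb{R}$, $\dim V=4$, and let $$I_2= e_0e_1\otimes e_2e_3+e_2e_3\otimes e_0e_1-e_0e_2\otimes e_1e_3-e_1e_3\otimes e_0e_2+e_0e_3\otimes e_1e_2+e_1e_2\otimes e_0e_3\in\Lambda^2V^{\vee}\otimes\Lambda^2V^{\vee}$$ be the exterior product invariant. Then the Euclidean reduction $f''(I_2):E\to T^{\vee}\otimes T^{\vee}$ is given, for $(r,u)\in E$, by the $3\times3$ matrix $$f''(I_2)(r,u)=r^{t}a,\qquad a=\begin{bmatrix} 0 & u_3 & -u_2 \\ -u_3 & 0 & u_1 \\ u_2 & -u_1 & 0 \end{bmatrix}.$$
   Context: $v_0,\dots,v_3$ is a basis of $V$, $e_0,\dots,e_3$ is the dual basis, and wedge signs are suppressed ($e_ie_j=e_i\wedge e_j$). $E\subset GL(V)$ is the Euclidean group, consisting of the matrices $g=\begin{bmatrix} 1 & 0 \\ u & r \end{bmatrix}$ (acting on column vectors) with $u=(u_1,u_2,u_3)^t\in\mathbb{R}^3$ and $r=[r_{ij}]\in SO(3)$; write $g=(r,u)$. Set $L=[v_0]^{\vee}$ where $[v_0]=\mathbb{R}v_0$, $W=(V/[v_0])^{\vee}$, $T=L\otimes W^{\vee}$. The choice of $v_0$ trivializes $L$, so $L\otimes W\cong W\cong T^{\vee}$, with basis $\tilde e_1,\tilde e_2,\tilde e_3$ induced by $e_1,e_2,e_3$; an element of $T^{\vee}\otimes T^{\vee}$ is written as a $3\times3$ matrix whose $(i,j)$ entry is the coefficient of $\tilde e_i\otimes\tilde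 e_j$. The map $\psi$ sends $\xi\in\Lambda^2V^{\vee}$ to the function on $GL(V)$ given by $g\mapsto\big(y\mapsto\xi(gv_0\wedge gy)\big)\in W$, $y\in V/[v_0]$. Finally $f''(I_2)(r,u)$ is the value of $(\psi\otimes\psi)(I_2)$ at the pair $\big((r,u),(\mathrm{id},0)\big)\in E\times E$. *)

theory Defs
  imports "HOL-Analysis.Analysis" "HOL-Library.Function_Algebras"
begin

subsection \<open>Function spaces as real vector spaces\<close>

instantiation "fun" :: (type, real_vector) real_vector
begin

definition scaleR_fun_def: "scaleR c f = (\<lambda>x. c *\<^sub>R f x)"

instance
  by standard (auto simp: scaleR_fun_def plus_fun_def fun_eq_iff algebra_simps)

end

lemma scaleR_fun_apply [simp]: "(c *\<^sub>R f) x = c *\<^sub>R f x"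
  by (simp add: scaleR_fun_def)

lemma sum_fun_apply: "(\<Sum>a\<in>A. f a) x = (\<Sum>a\<in>A. f a x)"
  by (induction A rule: infinite_finite_induct) auto

subsection \<open>Dual spaces and tensor products of subspaces\<close>

text \<open>Functions on a carrier are extended by \<open>0\<close> outside the carrier, so that equality of
  functions is equality on the carrier.\<close>

definition dual :: "'a::real_vector set \<Rightarrow> ('a \<Rightarrow> real) set" where
  "dual X = {\<phi>. (\<forall>x\<in>X. \<forall>y\<in>X. \<phi> (x + y) = \<phi> x + \<phi> y)
               \<and> (\<forall>c. \<forall>x\<in>X. \<phi> (c *\<^sub>R x) = c * \<phi> x)
               \<and> (\<forall>x. x \<notin> X \<longrightarrow> \<phi> x = 0)}"

text \<open>Over a field, \<open>X \<otimes> Y\<close> embeds into the bilinear forms on \<open>X\<^sup>\<or> \<times> Y\<^sup>\<or>\<close>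
  with \<open>x \<otimes> y\<close> acting as \<open>(\<phi>, \<omega>) \<mapsto> \<phi>(x) \<omega>(y)\<close>; it is realised here as the span of
  these forms. The universal property is \<open>tensor_universal\<close> and
  \<open>tensor_universal_unique\<close> below.\<close>

type_synonym ('a, 'b) tensor = "('a \<Rightarrow> real) \<Rightarrow> ('b \<Rightarrow> real) \<Rightarrow> real"

definition tensor :: "'a::real_vector set \<Rightarrow> 'b::real_vector set \<Rightarrow> 'a \<Rightarrow> 'b \<Rightarrow> ('a, 'b) tensor" where
  "tensor X Y x y = (\<lambda>\<phi> \<omega>. if \<phi> \<in> dual X \<and> \<omega> \<in> dual Y then \<phi> x * \<omega> y else 0)"

definition tensor_space :: "'a::real_vector set \<Rightarrow> 'b::real_vector set \<Rightarrow> ('a, 'b) tensor set" where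
  "tensor_space X Y = span {tensor X Y x y | x y. x \<in> X \<and> y \<in> Y}"

definition pullback :: "'a set \<Rightarrow> ('a \<Rightarrow> 'b) \<Rightarrow> ('b \<Rightarrow> real) \<Rightarrow> ('a \<Rightarrow> real)" where
  "pullback X f \<phi> = (\<lambda>x. if x \<in> X then \<phi> (f x) else 0)"

text \<open>The map \<open>f \<otimes> g : X \<otimes> Y \<rightarrow> X' \<otimes> Y'\<close> induced by linear maps \<open>f : X \<rightarrow> X'\<close> and
  \<open>g : Y \<rightarrow> Y'\<close>; see \<open>tensor_map_tensor\<close>.\<close>

definition tensor_map ::
  "'a::real_vector set \<Rightarrow> 'b::real_vector set \<Rightarrow> 'c::real_vector set \<Rightarrow> 'd::real_vector set
   \<Rightarrow> ('a \<Rightarrow> 'c) \<Rightarrow> ('b \<Rightarrow> 'd) \<Rightarrow> ('a, 'b) tensor \<Rightarrow> ('c, 'd) tensor" where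
  "tensor_map X Y X' Y' f g t =
     (\<lambda>\<phi> \<omega>. if \<phi> \<in> dual X' \<and> \<omega> \<in> dual Y' then t (pullback X f \<phi>) (pullback Y g \<omega>) else 0)"

definition linear_between :: "'a::real_vector set \<Rightarrow> 'b::real_vector set \<Rightarrow> ('a \<Rightarrow> 'b) \<Rightarrow> bool" where
  "linear_between X Y f \<longleftrightarrow> f ` X \<subseteq> Y \<and> (\<forall>x\<in>X. \<forall>y\<in>X. f (x + y) = f x + f y)
     \<and> (\<forall>c. \<forall>x\<in>X. f (c *\<^sub>R x) = c *\<^sub>R f x)"

lemma pullback_in_dual:
  assumes "subspace X" "linear_between X X' f" "\<phi> \<in> dual X'"
  shows "pullback X f \<phi> \<in> dual X"
  using assms unfolding dual_def linear_between_def pullback_def subspace_def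
  by (auto simp: image_subset_iff)

lemma tensor_map_tensor:
  assumes "subspace X" "subspace Y" "linear_between X X' f" "linear_between Y Y' g"
    and "x \<in> X" "y \<in> Y"
  shows "tensor_map X Y X' Y' f g (tensor X Y x y) = tensor X' Y' (f x) (g y)"
  using pullback_in_dual[OF assms(1,3)] pullback_in_dual[OF assms(2,4)] assms(5,6)
  by (auto simp: tensor_map_def tensor_def fun_eq_iff pullback_def)

lemma linear_tensor_map: "linear (tensor_map X Y X' Y' f g)"
  by (rule linearI) (auto simp: tensor_map_def fun_eq_iff)

lemma dual_coordinate:
  assumes "subspace X" "independent B" "span B = X"
  shows "(\<lambda>x. if x \<in> X then representation B x b else 0) \<in> dual X"
  using assms
  by (auto simp: dual_def subspace_add subspace_scale representation_add representation_scale)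

lemma tensor_independent:
  assumes X: "subspace X" "independent B" "B \<subseteq> X" and Y: "subspace Y" "independent C" "C \<subseteq> Y"
  shows "inj_on (\<lambda>(b, c). tensor X Y b c) (B \<times> C)"
    and "independent ((\<lambda>(b, c). tensor X Y b c) ` (B \<times> C))"
proof -
  obtain B' where B': "B \<subseteq> B'" "B' \<subseteq> X" "independent B'" "X \<subseteq> span B'"
    using maximal_independent_subset_extend[OF X(3,2)] by blast
  obtain C' where C': "C \<subseteq> C'" "C' \<subseteq> Y" "independent C'" "Y \<subseteq> span C'"
    using maximal_independent_subset_extend[OF Y(3,2)] by blast
  have sB: "span B' = X" by (rule span_subspace[OF B'(2,4) X(1)])
  have sC: "span C' = Y" by (rule span_subspace[OF C'(2,4) Y(1)])
  define p where "p b = (\<lambda>x. if x \<in> X then representation B' x b else 0)" for b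
  define q where "q c = (\<lambda>x. if x \<in> Y then representation C' x c else 0)" for c
  have p: "p b \<in> dual X" for b
    unfolding p_def by (rule dual_coordinate[OF X(1) B'(3) sB])
  have q: "q c \<in> dual Y" for c
    unfolding q_def by (rule dual_coordinate[OF Y(1) C'(3) sC])
  have ev: "tensor X Y b c (p b') (q c') = (if b = b' \<and> c = c' then 1 else 0)"
    if "b \<in> B" "c \<in> C" for b c b' c'
  proof -
    have "b \<in> B'" "c \<in> C'" "b \<in> X" "c \<in> Y" using that B' C' X(3) Y(3) by auto
    then show ?thesis
      by (simp add: tensor_def p q)
         (auto simp: p_def q_def representation_basis[OF B'(3)] representation_basis[OF C'(3)])
  qed
  show "inj_on (\<lambda>(b, c). tensor X Y b c) (B \<times> C)"
  proof (rule inj_onI, clarify)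
    fix b c b' c'
    assume *: "b \<in> B" "c \<in> C" "b' \<in> B" "c' \<in> C" "tensor X Y b c = tensor X Y b' c'"
    have "tensor X Y b' c' (p b) (q c) = 1"
      using ev[OF *(1,2), of b c] unfolding *(5) by simp
    then show "b = b' \<and> c = c'"
      unfolding ev[OF *(3,4)] by (simp split: if_splits)
  qed
  show "independent ((\<lambda>(b, c). tensor X Y b c) ` (B \<times> C))"
  proof
    assume "dependent ((\<lambda>(b, c). tensor X Y b c) ` (B \<times> C))"
    then obtain S k where Sk: "finite S \<and> S \<subseteq> (\<lambda>(b, c). tensor X Y b c) ` (B \<times> C)
        \<and> (\<exists>m\<in>S. k m \<noteq> 0) \<and> (\<Sum>m\<in>S. k m *\<^sub>R m) = 0"
      unfolding dependent_explicit by (elim exE conjE) (rule that, intro conjI)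
    then have S: "finite S" "S \<subseteq> (\<lambda>(b, c). tensor X Y b c) ` (B \<times> C)"
      and zero: "(\<Sum>m\<in>S. k m *\<^sub>R m) = 0" by simp_all
    obtain m where m: "m \<in> S" and nz: "k m \<noteq> 0" using Sk by (elim conjE bexE)
    have rep: "\<exists>b c. b \<in> B \<and> c \<in> C \<and> m' = tensor X Y b c" if "m' \<in> S" for m'
      using subsetD[OF S(2) that] by (rule imageE) (clarsimp, fast)
    obtain b c where bc: "b \<in> B" "c \<in> C" "m = tensor X Y b c"
      using rep[OF m] by (elim exE conjE)
    have val: "m' (p b) (q c) = (if m' = m then 1 else 0)" if m': "m' \<in> S" for m'
    proof -
      obtain b' c' where bc': "b' \<in> B" "c' \<in> C" "m' = tensor X Y b' c'"
        using rep[OF m'] by (elim exE conjE)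
      show ?thesis
      proof (cases "m' = m")
        case True
        then show ?thesis using ev[OF bc(1,2), of b c] bc(3) by simp
      next
        case False
        then have "\<not> (b' = b \<and> c' = c)" using bc(3) bc'(3) by auto
        then show ?thesis using ev[OF bc'(1,2), of b c] bc'(3) False by simp
      qed
    qed
    have "0 = (\<Sum>m'\<in>S. k m' *\<^sub>R m') (p b) (q c)" by (simp add: zero)
    also have "\<dots> = (\<Sum>m'\<in>S. if m' = m then k m' else 0)"
      unfolding sum_fun_apply by (intro sum.cong) (simp_all add: val)
    also have "\<dots> = k m" unfolding sum.delta[OF S(1)] if_P[OF m] ..
    finally show False using nz by simp
  qed
qed

lemma tensor_bilinear:
  assumes "subspace X" "subspace Y"
  shows "x \<in> X \<Longrightarrow> x' \<in> X \<Longrightarrow> tensor X Y (x + x') y = tensor X Y x y + tensor X Y x' y"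
    and "y \<in> Y \<Longrightarrow> y' \<in> Y \<Longrightarrow> tensor X Y x (y + y') = tensor X Y x y + tensor X Y x y'"
    and "x \<in> X \<Longrightarrow> tensor X Y (c *\<^sub>R x) y = c *\<^sub>R tensor X Y x y"
    and "y \<in> Y \<Longrightarrow> tensor X Y x (c *\<^sub>R y) = c *\<^sub>R tensor X Y x y"
  by (auto simp: tensor_def dual_def fun_eq_iff algebra_simps)

theorem tensor_universal:
  fixes h :: "'a::real_vector \<Rightarrow> 'b::real_vector \<Rightarrow> 'c::real_vector"
  assumes X: "subspace X" and Y: "subspace Y"
    and add1: "\<And>x x' y. x \<in> X \<Longrightarrow> x' \<in> X \<Longrightarrow> y \<in> Y \<Longrightarrow> h (x + x') y = h x y + h x' y"
    and add2: "\<And>x y y'. x \<in> X \<Longrightarrow> y \<in> Y \<Longrightarrow> y' \<in> Y \<Longrightarrow> h x (y + y') = h x y + h x y'"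
    and scale1: "\<And>c x y. x \<in> X \<Longrightarrow> y \<in> Y \<Longrightarrow> h (c *\<^sub>R x) y = c *\<^sub>R h x y"
    and scale2: "\<And>c x y. x \<in> X \<Longrightarrow> y \<in> Y \<Longrightarrow> h x (c *\<^sub>R y) = c *\<^sub>R h x y"
  obtains H where "linear H" "\<And>x y. x \<in> X \<Longrightarrow> y \<in> Y \<Longrightarrow> H (tensor X Y x y) = h x y"
proof -
  obtain B where B: "B \<subseteq> X" "independent B" "X \<subseteq> span B"
    by (rule maximal_independent_subset[of X])
  obtain C where C: "C \<subseteq> Y" "independent C" "Y \<subseteq> span C"
    by (rule maximal_independent_subset[of Y])
  let ?t = "\<lambda>(b, c). tensor X Y b c"
  have inj: "inj_on ?t (B \<times> C)" and ind: "independent (?t ` (B \<times> C))"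
    using tensor_independent[OF X B(2,1) Y C(2,1)] .
  define f where "f p = (case inv_into (B \<times> C) ?t p of (b, c) \<Rightarrow> h b c)" for p
  obtain H where "linear H \<and> (\<forall>p\<in>?t ` (B \<times> C). H p = f p)"
    using linear_independent_extend[OF ind, of f] by (rule exE)
  then have H: "linear H" and Hf: "\<forall>p\<in>?t ` (B \<times> C). H p = f p"
    by (rule conjunct1, rule conjunct2)
  have H0: "H (tensor X Y b c) = h b c" if "b \<in> B" "c \<in> C" for b c
  proof -
    have bc: "(b, c) \<in> B \<times> C" using that by simp
    have "H (?t (b, c)) = f (?t (b, c))" by (rule bspec[OF Hf imageI[OF bc]])
    also have "\<dots> = h b c" unfolding f_def inv_into_f_f[OF inj bc] by simp
    finally show ?thesis by simp
  qed
  have zero: "h 0 y = 0" if "y \<in> Y" for y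
    using scale1[of 0 y 0] X that by (simp add: subspace_0)
  have zero': "h x 0 = 0" if "x \<in> X" for x
    using scale2[of x 0 0] Y that by (simp add: subspace_0)
  have t0: "tensor X Y 0 y = 0" for y
    using tensor_bilinear(3)[OF X Y, of 0 0 y] X by (simp add: subspace_0)
  have t0': "tensor X Y x 0 = 0" for x
    using tensor_bilinear(4)[OF X Y, of 0 x 0] Y by (simp add: subspace_0)
  have H1: "H (tensor X Y x c) = h x c" if "x \<in> X" "c \<in> C" for x c
  proof -
    have "c \<in> Y" using that C by blast
    then have "subspace {x \<in> X. H (tensor X Y x c) = h x c}"
      unfolding subspace_def
      by (auto simp: subspace_add[OF X] subspace_scale[OF X] subspace_0[OF X] zero t0 add1 scale1
          tensor_bilinear[OF X Y] linear_0[OF H] linear_add[OF H] linear_scale[OF H])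
    moreover have "B \<subseteq> {x \<in> X. H (tensor X Y x c) = h x c}"
      using B H0 that by blast
    ultimately have "span B \<subseteq> {x \<in> X. H (tensor X Y x c) = h x c}"
      by (rule span_minimal[rotated])
    then show ?thesis using that B by blast
  qed
  have H2: "H (tensor X Y x y) = h x y" if "x \<in> X" "y \<in> Y" for x y
  proof -
    have "subspace {y \<in> Y. H (tensor X Y x y) = h x y}"
      unfolding subspace_def
      using that
      by (auto simp: subspace_add[OF Y] subspace_scale[OF Y] subspace_0[OF Y] zero' t0' add2 scale2
          tensor_bilinear[OF X Y] linear_0[OF H] linear_add[OF H] linear_scale[OF H])
    moreover have "C \<subseteq> {y \<in> Y. H (tensor X Y x y) = h x y}"
      using C H1 that by blast
    ultimately have "span C \<subseteq> {y \<in> Y. H (tensor X Y x y) = h x y}"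
      by (rule span_minimal[rotated])
    then show ?thesis using that C by blast
  qed
  show thesis by (rule that) (fact H, fact H2)
qed

lemma tensor_universal_unique:
  assumes "linear G" "linear H"
    and eq: "\<And>x y. x \<in> X \<Longrightarrow> y \<in> Y \<Longrightarrow> G (tensor X Y x y) = H (tensor X Y x y)"
    and t: "t \<in> tensor_space X Y"
  shows "G t = H t"
proof (rule linear_eq_on_span[OF assms(1,2) _ t[unfolded tensor_space_def]])
  show "\<And>s. s \<in> {tensor X Y x y | x y. x \<in> X \<and> y \<in> Y} \<Longrightarrow> G s = H s"
    using eq by auto
qed

subsection \<open>The space \<open>V\<close>, its forms and the Euclidean group\<close>

definition is_basis :: "(nat \<Rightarrow> 'v::real_vector) \<Rightarrow> bool" where
  "is_basis v \<longleftrightarrow> inj_on v {..<4} \<and> independent (v ` {..<4}) \<and> span (v ` {..<4}) = UNIV"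

definition e_form :: "(nat \<Rightarrow> 'v::real_vector) \<Rightarrow> nat \<Rightarrow> 'v \<Rightarrow> real" where
  "e_form v i x = representation (v ` {..<4}) x (v i)"

text \<open>\<open>\<Lambda>\<^sup>2 V\<^sup>\<or>\<close> as alternating bilinear forms, \<open>\<xi> x y\<close> standing for \<open>\<xi>(x \<and> y)\<close>.\<close>

definition alt_forms :: "('v::real_vector \<Rightarrow> 'v \<Rightarrow> real) set" where
  "alt_forms = {\<xi>. (\<forall>x. linear (\<xi> x)) \<and> (\<forall>y. linear (\<lambda>x. \<xi> x y)) \<and> (\<forall>x. \<xi> x x = 0)}"

definition wedge :: "('v \<Rightarrow> real) \<Rightarrow> ('v \<Rightarrow> real) \<Rightarrow> 'v \<Rightarrow> 'v \<Rightarrow> real" where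
  "wedge \<alpha> \<beta> = (\<lambda>x y. \<alpha> x * \<beta> y - \<alpha> y * \<beta> x)"

definition I2 :: "(nat \<Rightarrow> 'v::real_vector)
    \<Rightarrow> ('v \<Rightarrow> 'v \<Rightarrow> real, 'v \<Rightarrow> 'v \<Rightarrow> real) tensor" where
  "I2 v = (let ee = (\<lambda>i j. wedge (e_form v i) (e_form v j)); t = tensor alt_forms alt_forms in
       t (ee 0 1) (ee 2 3) + t (ee 2 3) (ee 0 1)
     - t (ee 0 2) (ee 1 3) - t (ee 1 3) (ee 0 2)
     + t (ee 0 3) (ee 1 2) + t (ee 1 2) (ee 0 3))"

definition GL :: "('v::real_vector \<Rightarrow> 'v) set" where
  "GL = {g. linear g \<and> bij g}"

definition matrix_map :: "(nat \<Rightarrow> 'v::real_vector) \<Rightarrow> (nat \<Rightarrow> nat \<Rightarrow> real) \<Rightarrow> 'v \<Rightarrow> 'v" where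
  "matrix_map v A x = (\<Sum>i<4. (\<Sum>j<4. A i j * e_form v j x) *\<^sub>R v i)"

text \<open>Row and column \<open>0\<close> belong to \<open>v\<^sub>0\<close>; \<open>of_nat\<close> sends \<open>1, 2, 3\<close> to the indices
  \<open>1, 2, 3\<close> of \<^typ>\<open>3\<close>.\<close>

definition euclid_matrix :: "real^3^3 \<Rightarrow> real^3 \<Rightarrow> nat \<Rightarrow> nat \<Rightarrow> real" where
  "euclid_matrix r u i j =
     (if i = 0 then (if j = 0 then 1 else 0)
      else if j = 0 then u $ of_nat i else r $ of_nat i $ of_nat j)"

definition euclid :: "(nat \<Rightarrow> 'v::real_vector) \<Rightarrow> (real^3^3) \<times> (real^3) \<Rightarrow> 'v \<Rightarrow> 'v" where
  "euclid v = (\<lambda>(r, u). matrix_map v (euclid_matrix r u))"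

definition euclidean_group :: "(nat \<Rightarrow> 'v::real_vector) \<Rightarrow> ('v \<Rightarrow> 'v) set" where
  "euclidean_group v = {euclid v (r, u) | r u. rotation_matrix r}"

subsection \<open>The spaces \<open>L\<close>, \<open>W\<close>, \<open>T\<close> and the map \<open>\<psi>\<close>\<close>

definition quot_rel :: "'v::real_vector \<Rightarrow> ('v \<times> 'v) set" where
  "quot_rel v0 = {(x, y). x - y \<in> span {v0}}"

definition coset :: "'v::real_vector \<Rightarrow> 'v \<Rightarrow> 'v set" where
  "coset v0 y = quot_rel v0 `` {y}"

definition L_space :: "'v::real_vector \<Rightarrow> ('v \<Rightarrow> real) set" where
  "L_space v0 = dual (span {v0})"

text \<open>Linear functionals on the quotient \<open>V / [v\<^sub>0]\<close>, whose points are the cosets and whose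
  operations are those of representatives.\<close>

definition W_space :: "'v::real_vector \<Rightarrow> ('v set \<Rightarrow> real) set" where
  "W_space v0 = {w. (\<forall>x y. w (coset v0 (x + y)) = w (coset v0 x) + w (coset v0 y))
                  \<and> (\<forall>c x. w (coset v0 (c *\<^sub>R x)) = c * w (coset v0 x))
                  \<and> (\<forall>A. A \<notin> UNIV // quot_rel v0 \<longrightarrow> w A = 0)}"

definition T_space :: "'v::real_vector \<Rightarrow> ('v \<Rightarrow> real, ('v set \<Rightarrow> real) \<Rightarrow> real) tensor set" where
  "T_space v0 = tensor_space (L_space v0) (dual (W_space v0))"

definition GL_functions :: "'v::real_vector \<Rightarrow> (('v \<Rightarrow> 'v) \<Rightarrow> 'v set \<Rightarrow> real) set" where
  "GL_functions v0 = {F. (\<forall>g\<in>GL. F g \<in> W_space v0) \<and> (\<forall>g. g \<notin> GL \<longrightarrow> F g = 0)}"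

text \<open>The value at a coset does not depend on the representative; see \<open>psi_coset\<close>.\<close>

definition psi :: "'v::real_vector \<Rightarrow> ('v \<Rightarrow> 'v \<Rightarrow> real) \<Rightarrow> ('v \<Rightarrow> 'v) \<Rightarrow> 'v set \<Rightarrow> real" where
  "psi v0 \<xi> g A =
     (if g \<in> GL \<and> A \<in> UNIV // quot_rel v0 then \<xi> (g v0) (g (SOME y. y \<in> A)) else 0)"

text \<open>The isomorphism \<open>W \<rightarrow> T\<^sup>\<or>\<close> given by the trivialisation of \<open>L\<close>: the functional
  \<open>l \<otimes> \<phi> \<mapsto> l(v\<^sub>0) \<phi>(w)\<close> on \<open>T = L \<otimes> W\<^sup>\<or>\<close>; see \<open>W_to_T_dual_tensor\<close>.\<close>

definition W_to_T_dual :: "'v::real_vector \<Rightarrow> ('v set \<Rightarrow> real)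
    \<Rightarrow> ('v \<Rightarrow> real, ('v set \<Rightarrow> real) \<Rightarrow> real) tensor \<Rightarrow> real" where
  "W_to_T_dual v0 w t =
     (if t \<in> T_space v0
      then t (\<lambda>l. if l \<in> L_space v0 then l v0 else 0)
             (\<lambda>\<phi>. if \<phi> \<in> dual (W_space v0) then \<phi> w else 0)
      else 0)"

definition e_bar :: "(nat \<Rightarrow> 'v::real_vector) \<Rightarrow> nat \<Rightarrow> 'v set \<Rightarrow> real" where
  "e_bar v i A = (if A \<in> UNIV // quot_rel (v 0) then e_form v i (SOME y. y \<in> A) else 0)"

definition e_tilde :: "(nat \<Rightarrow> 'v::real_vector) \<Rightarrow> nat
    \<Rightarrow> ('v \<Rightarrow> real, ('v set \<Rightarrow> real) \<Rightarrow> real) tensor \<Rightarrow> real" where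
  "e_tilde v i = W_to_T_dual (v 0) (e_bar v i)"

text \<open>\<open>(\<psi> \<otimes> \<psi>)(I)\<close> is evaluated at \<open>((r, u), (id, 0))\<close>, and \<open>W \<otimes> W\<close> is identified
  with \<open>T\<^sup>\<or> \<otimes> T\<^sup>\<or>\<close> as above.\<close>

definition euclidean_reduction :: "(nat \<Rightarrow> 'v::real_vector)
    \<Rightarrow> ('v \<Rightarrow> 'v \<Rightarrow> real, 'v \<Rightarrow> 'v \<Rightarrow> real) tensor \<Rightarrow> (real^3^3) \<times> (real^3)
    \<Rightarrow> (('v \<Rightarrow> real, ('v set \<Rightarrow> real) \<Rightarrow> real) tensor \<Rightarrow> real,
        ('v \<Rightarrow> real, ('v set \<Rightarrow> real) \<Rightarrow> real) tensor \<Rightarrow> real) tensor" where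
  "euclidean_reduction v I p =
     (let F = GL_functions (v 0); T' = dual (T_space (v 0));
          ev = (\<lambda>g \<eta>. W_to_T_dual (v 0) (\<eta> g))
      in tensor_map F F T' T' (ev (euclid v p)) (ev (euclid v (mat 1, 0)))
           (tensor_map alt_forms alt_forms F F (psi (v 0)) (psi (v 0)) I))"

subsection \<open>Well-definedness\<close>

lemma e_form_linear: "is_basis v \<Longrightarrow> linear (e_form v i)"
  by (rule linearI) (auto simp: e_form_def is_basis_def representation_add representation_scale)

lemma e_form_basis:
  assumes "is_basis v" "i < 4" "j < 4"
  shows "e_form v i (v j) = (if i = j then 1 else 0)"
  using assms by (auto simp: e_form_def is_basis_def representation_basis inj_on_def)

lemma basis_expansion:
  assumes "is_basis v"
  shows "x = (\<Sum>i<4. e_form v i x *\<^sub>R v i)"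
proof -
  have "x = (\<Sum>b\<in>v ` {..<4}. representation (v ` {..<4}) x b *\<^sub>R b)"
    using assms by (intro sum_representation_eq[symmetric]) (auto simp: is_basis_def)
  then show ?thesis using assms by (simp add: is_basis_def sum.reindex e_form_def)
qed

lemma alt_forms_simps:
  assumes "\<xi> \<in> alt_forms"
  shows "\<xi> (x + x') y = \<xi> x y + \<xi> x' y" "\<xi> (c *\<^sub>R x) y = c * \<xi> x y"
    and "\<xi> x (y + y') = \<xi> x y + \<xi> x y'" "\<xi> x (c *\<^sub>R y) = c * \<xi> x y" "\<xi> x x = 0"
proof -
  have l: "linear (\<lambda>x. \<xi> x y)" for y using assms by (simp add: alt_forms_def)
  have r: "linear (\<xi> x)" for x using assms by (simp add: alt_forms_def)
  show "\<xi> (x + x') y = \<xi> x y + \<xi> x' y" using linear_add[OF l] .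
  show "\<xi> (c *\<^sub>R x) y = c * \<xi> x y" using linear_scale[OF l, of c x y] by simp
  show "\<xi> x (y + y') = \<xi> x y + \<xi> x y'" using linear_add[OF r] .
  show "\<xi> x (c *\<^sub>R y) = c * \<xi> x y" using linear_scale[OF r, of x c y] by simp
  show "\<xi> x x = 0" using assms by (simp add: alt_forms_def)
qed

lemma alt_formsI:
  assumes "\<And>x x' y. \<xi> (x + x') y = \<xi> x y + \<xi> x' y" "\<And>c x y. \<xi> (c *\<^sub>R x) y = c * \<xi> x y"
    and "\<And>x y y'. \<xi> x (y + y') = \<xi> x y + \<xi> x y'" "\<And>c x y. \<xi> x (c *\<^sub>R y) = c * \<xi> x y"
    and "\<And>x. \<xi> x x = 0"
  shows "\<xi> \<in> alt_forms"
  unfolding alt_forms_def using assms by (auto intro!: linearI)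

lemma wedge_alt:
  assumes "linear \<alpha>" "linear \<beta>"
  shows "wedge \<alpha> \<beta> \<in> alt_forms"
  by (rule alt_formsI) (simp_all add: wedge_def linear_add[OF assms(1)] linear_add[OF assms(2)]
      linear_scale[OF assms(1)] linear_scale[OF assms(2)] algebra_simps)

lemma subspace_alt_forms: "subspace alt_forms"
proof (rule subspaceI)
  show "0 \<in> alt_forms" by (rule alt_formsI) simp_all
  show "\<xi> + \<eta> \<in> alt_forms" if "\<xi> \<in> alt_forms" "\<eta> \<in> alt_forms"
    for \<xi> \<eta> :: "'a \<Rightarrow> 'a \<Rightarrow> real"
    by (rule alt_formsI)
       (simp_all add: alt_forms_simps[OF that(1)] alt_forms_simps[OF that(2)] algebra_simps)
  show "c *\<^sub>R \<xi> \<in> alt_forms" if "\<xi> \<in> alt_forms" for c and \<xi> :: "'a \<Rightarrow> 'a \<Rightarrow> real"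
    by (rule alt_formsI) (simp_all add: alt_forms_simps[OF that] algebra_simps)
qed

lemma subspace_dual: "subspace (dual X)"
  unfolding subspace_def dual_def by (auto simp: algebra_simps)

lemma subspace_W: "subspace (W_space v0)"
  unfolding subspace_def W_space_def by (auto simp: algebra_simps)

lemma subspace_GL_functions: "subspace (GL_functions v0)"
  unfolding subspace_def GL_functions_def using subspace_W[of v0, unfolded subspace_def] by auto

lemma equiv_quot_rel: "equiv UNIV (quot_rel v0)"
proof (rule equivI)
  show "sym (quot_rel v0)"
    unfolding sym_def quot_rel_def using span_neg by fastforce
  show "trans (quot_rel v0)"
    unfolding trans_def quot_rel_def
    using span_add by fastforce
qed (auto simp: refl_on_def quot_rel_def span_zero)

lemma coset_in_quotient: "coset v0 y \<in> UNIV // quot_rel v0"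
  by (auto simp: coset_def quotient_def)

lemma coset_rep: obtains c where "(SOME z. z \<in> coset v0 y) = y + c *\<^sub>R v0"
proof -
  have "y \<in> coset v0 y" by (simp add: coset_def quot_rel_def span_zero)
  then have "(SOME z. z \<in> coset v0 y) \<in> coset v0 y" by (rule someI)
  then have "y - (SOME z. z \<in> coset v0 y) \<in> span {v0}" by (simp add: coset_def quot_rel_def)
  then obtain k where "y - (SOME z. z \<in> coset v0 y) = k *\<^sub>R v0" by (auto simp: span_singleton)
  then have "(SOME z. z \<in> coset v0 y) = y + (- k) *\<^sub>R v0" by (simp add: algebra_simps)
  then show thesis using that by blast
qed

lemma psi_coset:
  assumes "\<xi> \<in> alt_forms" "g \<in> GL"
  shows "psi v0 \<xi> g (coset v0 y) = \<xi> (g v0) (g y)"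
proof -
  obtain c where c: "(SOME z. z \<in> coset v0 y) = y + c *\<^sub>R v0" by (rule coset_rep)
  have g: "linear g" using assms(2) by (simp add: GL_def)
  show ?thesis using assms(2) coset_in_quotient[of v0 y]
    by (simp add: psi_def c linear_add[OF g] linear_scale[OF g] alt_forms_simps[OF assms(1)])
qed

lemma psi_linear: "linear_between alt_forms (GL_functions v0) (psi v0)"
proof -
  have W: "psi v0 \<xi> g \<in> W_space v0" if "\<xi> \<in> alt_forms" "g \<in> GL" for \<xi> g
  proof -
    have g: "linear g" using that(2) by (simp add: GL_def)
    show ?thesis
      unfolding W_space_def
      by (simp add: psi_coset[OF that] linear_add[OF g] linear_scale[OF g]
          alt_forms_simps[OF that(1)]) (simp add: psi_def)
  qed
  have "psi v0 \<xi> \<in> GL_functions v0" if "\<xi> \<in> alt_forms" for \<xi>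
    using W[OF that] by (simp add: GL_functions_def psi_def fun_eq_iff)
  then show ?thesis by (simp add: linear_between_def psi_def fun_eq_iff image_subset_iff)
qed

lemma e_bar_coset:
  assumes "is_basis v" "i \<in> {1..3}"
  shows "e_bar v i (coset (v 0) y) = e_form v i y"
proof -
  obtain c where c: "(SOME z. z \<in> coset (v 0) y) = y + c *\<^sub>R v 0" by (rule coset_rep)
  show ?thesis
    using assms coset_in_quotient[of "v 0" y] e_form_basis[OF assms(1), of i 0]
    by (simp add: e_bar_def c linear_add[OF e_form_linear[OF assms(1)]]
        linear_scale[OF e_form_linear[OF assms(1)]])
qed

lemma e_bar_in_W:
  assumes "is_basis v" "i \<in> {1..3}"
  shows "e_bar v i \<in> W_space (v 0)"
  unfolding W_space_def
  by (simp add: e_bar_coset[OF assms] linear_add[OF e_form_linear[OF assms(1)]]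
      linear_scale[OF e_form_linear[OF assms(1)]]) (simp add: e_bar_def)

lemma eval_dual: "(\<lambda>\<phi>. if \<phi> \<in> dual X then \<phi> x else 0) \<in> dual (dual X)"
  by (simp add: dual_def[of "dual X"] subspace_add[OF subspace_dual] subspace_scale[OF subspace_dual])

lemma W_to_T_dual_tensor:
  assumes "l \<in> L_space v0" "\<phi> \<in> dual (W_space v0)"
  shows "W_to_T_dual v0 w (tensor (L_space v0) (dual (W_space v0)) l \<phi>) = l v0 * \<phi> w"
proof -
  have "tensor (L_space v0) (dual (W_space v0)) l \<phi> \<in> T_space v0"
    unfolding T_space_def tensor_space_def by (rule span_base) (use assms in blast)
  then show ?thesis
    using assms eval_dual[of "span {v0}" v0, folded L_space_def] eval_dual[of "W_space v0" w]
    by (simp add: W_to_T_dual_def tensor_def)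
qed

lemma tensor_space_bilinear:
  assumes "t \<in> tensor_space X Y" "\<phi> \<in> dual X" "\<omega> \<in> dual Y"
  shows "\<omega>' \<in> dual Y \<Longrightarrow> t \<phi> (\<omega> + \<omega>') = t \<phi> \<omega> + t \<phi> \<omega>'"
    and "t \<phi> (c *\<^sub>R \<omega>) = c * t \<phi> \<omega>"
proof -
  have pure: "\<exists>x y. s = tensor X Y x y" if "s \<in> {tensor X Y x y | x y. x \<in> X \<and> y \<in> Y}" for s
    using that by auto
  show "t \<phi> (\<omega> + \<omega>') = t \<phi> \<omega> + t \<phi> \<omega>'" if \<omega>': "\<omega>' \<in> dual Y"
    using assms(1)[unfolded tensor_space_def]
  proof (induction rule: span_induct_alt)
    case base
    then show ?case by simp
  next
    case (step c s t')
    obtain x y where s: "s = tensor X Y x y" using pure[OF step(1)] by (elim exE)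
    have "s \<phi> (\<omega> + \<omega>') = s \<phi> \<omega> + s \<phi> \<omega>'"
      using assms(2,3) \<omega>' subspace_add[OF subspace_dual assms(3) \<omega>']
      unfolding s tensor_def by (simp only: if_True simp_thms plus_fun_apply distrib_left)
    moreover have "(c *\<^sub>R s + t') \<phi> \<eta> = c * s \<phi> \<eta> + t' \<phi> \<eta>" for \<eta> by simp
    ultimately show ?case
      using step(2) by (simp only: distrib_left add_ac)
  qed
  show "t \<phi> (c *\<^sub>R \<omega>) = c * t \<phi> \<omega>"
    using assms(1)[unfolded tensor_space_def]
  proof (induction rule: span_induct_alt)
    case base
    then show ?case by simp
  next
    case (step k s t')
    obtain x y where s: "s = tensor X Y x y" using pure[OF step(1)] by (elim exE)
    have "s \<phi> (c *\<^sub>R \<omega>) = c * s \<phi> \<omega>"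
      using assms(2,3) subspace_scale[OF subspace_dual assms(3), of c]
      unfolding s tensor_def
      by (simp only: if_True simp_thms scaleR_fun_apply real_scaleR_def mult.left_commute)
    moreover have "(k *\<^sub>R s + t') \<phi> \<eta> = k * s \<phi> \<eta> + t' \<phi> \<eta>" for \<eta> by simp
    ultimately show ?case
      using step(2) by (simp only: distrib_left mult.left_commute)
  qed
qed

lemma W_to_T_dual_linear: "linear_between (W_space v0) (dual (T_space v0)) (W_to_T_dual v0)"
proof -
  let ?D = "dual (W_space v0)"
  let ?l = "\<lambda>l. if l \<in> L_space v0 then l v0 else 0"
  let ?w = "\<lambda>w \<phi>. if \<phi> \<in> ?D then \<phi> w else (0::real)"
  have l: "?l \<in> dual (L_space v0)" unfolding L_space_def by (rule eval_dual)
  have w: "?w w \<in> dual ?D" for w by (rule eval_dual)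
  have add: "?w (w + w') = ?w w + ?w w'" if "w \<in> W_space v0" "w' \<in> W_space v0" for w w'
    using that by (auto simp: fun_eq_iff dual_def)
  have scale: "?w (c *\<^sub>R w) = c *\<^sub>R ?w w" if "w \<in> W_space v0" for c w
    using that by (auto simp: fun_eq_iff dual_def)
  have sub: "subspace (T_space v0)" by (simp add: T_space_def tensor_space_def)
  have "W_to_T_dual v0 w \<in> dual (T_space v0)" for w
    by (simp add: W_to_T_dual_def dual_def[of "T_space v0"] subspace_add[OF sub] subspace_scale[OF sub])
  moreover have "W_to_T_dual v0 (w + w') = W_to_T_dual v0 w + W_to_T_dual v0 w'"
    if "w \<in> W_space v0" "w' \<in> W_space v0" for w w'
    using tensor_space_bilinear(1)[OF _ l w w] unfolding W_to_T_dual_def add[OF that] T_space_def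
    by (auto simp: fun_eq_iff)
  moreover have "W_to_T_dual v0 (c *\<^sub>R w) = c *\<^sub>R W_to_T_dual v0 w" if "w \<in> W_space v0" for c w
    using tensor_space_bilinear(2)[OF _ l w] unfolding W_to_T_dual_def scale[OF that] T_space_def
    by (auto simp: fun_eq_iff)
  ultimately show ?thesis by (auto simp: linear_between_def)
qed

lemma matrix_map_basis:
  assumes "is_basis v" "j < 4"
  shows "matrix_map v A (v j) = (\<Sum>i<4. A i j *\<^sub>R v i)"
proof -
  have "(\<Sum>k<4. A i k * e_form v k (v j)) = (\<Sum>k<4. if k = j then A i k else 0)" for i
    using e_form_basis[OF assms(1) _ assms(2)] by (intro sum.cong) auto
  then show ?thesis using assms(2) by (simp add: matrix_map_def)
qed

lemma euclidean_group_subset_GL: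
  assumes "is_basis v"
  shows "euclidean_group v \<subseteq> GL"
proof -
  have lin: "linear (matrix_map v A)" for A
    by (rule linearI)
       (simp_all add: matrix_map_def linear_add[OF e_form_linear[OF assms]]
        linear_scale[OF e_form_linear[OF assms]] distrib_left sum.distrib scaleR_left_distrib
        scaleR_sum_right sum_distrib_left mult.left_commute)
  have coord: "e_form v i (matrix_map v A x) = (\<Sum>j<4. A i j * e_form v j x)" if "i < 4" for i A x
  proof -
    have "e_form v i (matrix_map v A x)
        = (\<Sum>k<4. (\<Sum>j<4. A k j * e_form v j x) * e_form v i (v k))"
      by (simp add: matrix_map_def linear_sum[OF e_form_linear[OF assms]]
          linear_scale[OF e_form_linear[OF assms]])
    also have "\<dots> = (\<Sum>k<4. if k = i then (\<Sum>j<4. A k j * e_form v j x) else 0)"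
      using e_form_basis[OF assms that] by (intro sum.cong) auto
    finally show ?thesis using that by simp
  qed
  have comp: "matrix_map v A (matrix_map v B x) = x"
    if AB: "\<And>i j. i < 4 \<Longrightarrow> j < 4 \<Longrightarrow> (\<Sum>k<4. A i k * B k j) = (if i = j then 1 else 0)" for A B x
  proof -
    have "(\<Sum>j<4. A i j * e_form v j (matrix_map v B x)) = e_form v i x" if "i < 4" for i
    proof -
      have "(\<Sum>j<4. A i j * e_form v j (matrix_map v B x))
          = (\<Sum>j<4. \<Sum>k<4. A i j * B j k * e_form v k x)"
        by (simp add: coord sum_distrib_left mult.assoc)
      also have "\<dots> = (\<Sum>k<4. (\<Sum>j<4. A i j * B j k) * e_form v k x)"
        by (subst sum.swap) (simp add: sum_distrib_right)
      also have "\<dots> = (\<Sum>k<4. if k = i then e_form v k x else 0)"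
        using AB[OF that] by (intro sum.cong) auto
      finally show ?thesis using that by simp
    qed
    then have "matrix_map v A (matrix_map v B x) = (\<Sum>i<4. e_form v i x *\<^sub>R v i)"
      by (simp add: matrix_map_def[of v A])
    then show ?thesis using basis_expansion[OF assms, of x] by simp
  qed
  have "bij (matrix_map v (euclid_matrix r u))" if "rotation_matrix r" for r u
  proof -
    have r: "transpose r ** r = mat 1" "r ** transpose r = mat 1"
      using that by (auto simp: rotation_matrix_def orthogonal_matrix_def)
    have r1: "(\<Sum>k\<in>UNIV. r $ k $ i * r $ k $ j) = (if i = j then 1 else 0)" for i j
      using arg_cong[OF r(1), of "\<lambda>M. M $ i $ j"]
      by (simp add: matrix_matrix_mult_def transpose_def mat_def)
    have r2: "(\<Sum>k\<in>UNIV. r $ i $ k * r $ j $ k) = (if i = j then 1 else 0)" for i j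
      using arg_cong[OF r(2), of "\<lambda>M. M $ i $ j"]
      by (simp add: matrix_matrix_mult_def transpose_def mat_def)
    have l4: "i < 4 \<longleftrightarrow> i = 0 \<or> i = 1 \<or> i = 2 \<or> i = 3" for i :: nat by auto
    have s4: "sum f {..<4} = f 0 + f 1 + f 2 + f 3" for f :: "nat \<Rightarrow> real"
      by (simp add: eval_nat_numeral)
    let ?A = "euclid_matrix r u"
    let ?B = "euclid_matrix (transpose r) (- (transpose r *v u))"
    have d3: "(1::3) \<noteq> 2" "(1::3) \<noteq> 3" "(2::3) \<noteq> 3" "(2::3) \<noteq> 1" "(3::3) \<noteq> 1" "(3::3) \<noteq> 2"
      by simp_all
    have AB: "(\<Sum>k<4. ?A i k * ?B k j) = (if i = j then 1 else 0)" if "i < 4" "j < 4" for i j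
    proof -
      have col: "(\<Sum>k<4. ?A i k * ?B k 0) = 0" if "i \<noteq> 0"
      proof -
        have "(\<Sum>k<4. ?A i k * ?B k 0) = u $ of_nat i -
            ((\<Sum>l\<in>UNIV. (\<Sum>k\<in>UNIV. r $ of_nat i $ k * r $ l $ k) * u $ l))"
          using that by (simp add: s4 euclid_matrix_def matrix_vector_mult_def transpose_def
              sum_3 algebra_simps)
        moreover have "(\<Sum>l\<in>UNIV. (if of_nat i = l then 1 else 0) * u $ l)
            = (\<Sum>l\<in>UNIV. if l = of_nat i then u $ l else 0)"
          by (intro sum.cong) auto
        ultimately show ?thesis unfolding r2 by simp
      qed
      have rest: "(\<Sum>k<4. ?A i k * ?B k j) = (\<Sum>k\<in>UNIV. r $ of_nat i $ k * r $ of_nat j $ k)"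
        if "i \<noteq> 0" "j \<noteq> 0"
        using that by (simp add: s4 euclid_matrix_def transpose_def sum_3)
      have inj: "(of_nat i :: 3) = of_nat j \<longleftrightarrow> i = j" if "i \<noteq> 0" "j \<noteq> 0"
        using that \<open>i < 4\<close> \<open>j < 4\<close> d3 unfolding l4 by auto
      show ?thesis
      proof (cases "i = 0")
        case True
        then show ?thesis by (simp add: s4 euclid_matrix_def)
      next
        case False
        then show ?thesis using col rest inj r2 by (cases "j = 0") auto
      qed
    qed
    have BA: "(\<Sum>k<4. ?B i k * ?A k j) = (if i = j then 1 else 0)" if "i < 4" "j < 4" for i j
    proof -
      have col: "(\<Sum>k<4. ?B i k * ?A k 0) = 0" if "i \<noteq> 0"
        using that by (simp add: s4 euclid_matrix_def matrix_vector_mult_def transpose_def sum_3)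
      have rest: "(\<Sum>k<4. ?B i k * ?A k j) = (\<Sum>k\<in>UNIV. r $ k $ of_nat i * r $ k $ of_nat j)"
        if "i \<noteq> 0" "j \<noteq> 0"
        using that by (simp add: s4 euclid_matrix_def transpose_def sum_3)
      have inj: "(of_nat i :: 3) = of_nat j \<longleftrightarrow> i = j" if "i \<noteq> 0" "j \<noteq> 0"
        using that \<open>i < 4\<close> \<open>j < 4\<close> d3 unfolding l4 by auto
      show ?thesis
      proof (cases "i = 0")
        case True
        then show ?thesis by (simp add: s4 euclid_matrix_def)
      next
        case False
        then show ?thesis using col rest inj r1 by (cases "j = 0") auto
      qed
    qed
    have inv: "matrix_map v ?A (matrix_map v ?B x) = x" "matrix_map v ?B (matrix_map v ?A x) = x" for x
      by (rule comp, erule AB, assumption) (rule comp, erule BA, assumption)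
    show ?thesis by (rule bij_betw_byWitness[where f' = "matrix_map v ?B"]) (simp_all only: inv, simp_all)
  qed
  then show ?thesis using lin by (auto simp: euclidean_group_def GL_def euclid_def)
qed

lemma e_tilde_independent:
  assumes "is_basis v"
  shows "inj_on (e_tilde v) {1..3}" and "independent (e_tilde v ` {1..3})"
    and "e_tilde v ` {1..3} \<subseteq> dual (T_space (v 0))"
proof -
  let ?W = "W_space (v 0)"
  define l where "l x = (if x \<in> span {v 0} then e_form v 0 x else 0)" for x
  define f where "f j w = (if w \<in> ?W then w (coset (v 0) (v j)) else 0)" for j w
  define t where "t j = tensor (L_space (v 0)) (dual ?W) l (f j)" for j
  have l: "l \<in> L_space (v 0)"
    using e_form_linear[OF assms]
    by (auto simp: L_space_def dual_def l_def span_add span_scale linear_add linear_scale)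
  have f: "f j \<in> dual ?W" for j
    using subspace_W[of "v 0"] by (auto simp: dual_def f_def subspace_add subspace_scale)
  have l1: "l (v 0) = 1" using e_form_basis[OF assms, of 0 0] by (simp add: l_def span_base)
  have ev: "e_tilde v i (t j) = (if i = j then 1 else 0)" if "i \<in> {1..3}" "j \<in> {1..3}" for i j
    using that e_form_basis[OF assms, of i j] e_bar_in_W[OF assms that(1)]
    by (simp add: e_tilde_def t_def W_to_T_dual_tensor[OF l f] l1 f_def
        e_bar_coset[OF assms that(1)])
  show inj: "inj_on (e_tilde v) {1..3}"
    by (rule inj_onI) (metis ev zero_neq_one)
  show "independent (e_tilde v ` {1..3})"
  proof
    assume "dependent (e_tilde v ` {1..3})"
    then obtain k where nz: "\<exists>m\<in>e_tilde v ` {1..3}. k m \<noteq> 0"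
      and zero: "(\<Sum>m\<in>e_tilde v ` {1..3}. k m *\<^sub>R m) = 0"
      unfolding dependent_finite[OF finite_imageI[OF finite_atLeastAtMost]]
      by (elim exE conjE) (rule that)
    obtain j where j: "j \<in> {1..3}" "k (e_tilde v j) \<noteq> 0"
      using nz by (elim bexE imageE) (rule that, simp_all)
    have "0 = (\<Sum>i\<in>{1..3}. k (e_tilde v i) *\<^sub>R e_tilde v i) (t j)"
      using zero unfolding sum.reindex[OF inj] o_def by simp
    also have "\<dots> = (\<Sum>i\<in>{1..3}. if i = j then k (e_tilde v i) else 0)"
      unfolding sum_fun_apply using j by (intro sum.cong) (auto simp: ev)
    also have "\<dots> = k (e_tilde v j)" using j by simp
    finally show False using j by simp
  qed
  show "e_tilde v ` {1..3} \<subseteq> dual (T_space (v 0))"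
    using W_to_T_dual_linear[of "v 0"] e_bar_in_W[OF assms]
    by (auto simp: e_tilde_def linear_between_def)
qed

text \<open>The coefficients with respect to the tensors \<open>e_tilde v i \<otimes> e_tilde v j\<close> are unique.\<close>

lemma matrix_tensor_unique:
  fixes v :: "nat \<Rightarrow> 'v::real_vector" and A B :: "nat \<Rightarrow> nat \<Rightarrow> real"
  defines "t \<equiv> tensor (dual (T_space (v 0))) (dual (T_space (v 0)))"
  assumes "is_basis v"
    and eq: "(\<Sum>i=1..3. \<Sum>j=1..3. A i j *\<^sub>R t (e_tilde v i) (e_tilde v j))
           = (\<Sum>i=1..3. \<Sum>j=1..3. B i j *\<^sub>R t (e_tilde v i) (e_tilde v j))"
    and ij: "i \<in> {1..3}" "j \<in> {1..3}"
  shows "A i j = B i j"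
proof -
  note e = e_tilde_independent[OF assms(2)]
  let ?I = "{1..3::nat} \<times> {1..3::nat}"
  define h where "h = (\<lambda>(i, j). t (e_tilde v i) (e_tilde v j))"
  have h: "h = (\<lambda>(b, c). t b c) \<circ> map_prod (e_tilde v) (e_tilde v)" by (auto simp: h_def)
  have im: "map_prod (e_tilde v) (e_tilde v) ` ?I = e_tilde v ` {1..3} \<times> e_tilde v ` {1..3}"
    by (rule map_prod_surj_on) auto
  have inj: "inj_on h ?I"
    unfolding h t_def
    by (rule comp_inj_on[OF map_prod_inj_on[OF e(1) e(1)]], unfold im,
        rule tensor_independent(1)[OF subspace_dual e(2,3) subspace_dual e(2,3)])
  have ind: "independent (h ` ?I)"
    unfolding h t_def image_comp[symmetric] im
    by (rule tensor_independent(2)[OF subspace_dual e(2,3) subspace_dual e(2,3)])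
  let ?d = "\<lambda>p. A (fst p) (snd p) - B (fst p) (snd p)"
  have "(\<Sum>p\<in>?I. ?d p *\<^sub>R h p) = 0"
    using eq by (simp add: sum.cartesian_product h_def case_prod_beta scaleR_diff_left sum_subtractf)
  then have "(\<Sum>m\<in>h ` ?I. ?d (inv_into ?I h m) *\<^sub>R m) = 0"
    unfolding sum.reindex[OF inj] o_def by (simp only: inv_into_f_f[OF inj] cong: sum.cong)
  moreover have "h (i, j) \<in> h ` ?I" using ij by (intro imageI SigmaI)
  ultimately have "?d (inv_into ?I h (h (i, j))) = 0"
    using independentD[OF ind finite_imageI[OF finite_cartesian_product[OF finite_atLeastAtMost
        finite_atLeastAtMost]] subset_refl, of "\<lambda>m. ?d (inv_into ?I h m)" "h (i, j)"] by simp
  moreover have "inv_into ?I h (h (i, j)) = (i, j)" using ij by (intro inv_into_f_f[OF inj] SigmaI)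
  ultimately show ?thesis by simp
qed

end

theory Submission
  imports Defs
begin

text \<open>The reduction is linear in the tensor, and on a pure tensor \<open>\<xi> \<otimes> \<eta>\<close> its \<open>(i, j)\<close>
  coefficient at \<open>(g, id)\<close> is \<open>\<xi>(g v\<^sub>0, g v\<^sub>i) \<eta>(v\<^sub>0, v\<^sub>j)\<close>. The factor \<open>\<eta>(v\<^sub>0, v\<^sub>j)\<close> kills every
  term of \<open>I\<^sub>2\<close> whose second factor does not involve \<open>e\<^sub>0\<close>; in the three surviving terms it is
  \<open>1\<close> for one \<open>j\<close> only, so that the first factors, which are the \<open>2 \<times> 2\<close> minors of \<open>u\<close>
  against the columns of \<open>r\<close>, are the columns of \<open>r\<^sup>t a\<close>.\<close>

lemma GL_id: "id \<in> GL"
  by (simp add: GL_def linear_id)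

lemma euclid_in_GL:
  assumes "is_basis v" "rotation_matrix r"
  shows "euclid v (r, u) \<in> GL"
  using euclidean_group_subset_GL[OF assms(1)] assms(2) by (auto simp: euclidean_group_def)

lemma e_form_matrix_map:
  assumes "is_basis v" "i < 4" "j < 4"
  shows "e_form v i (matrix_map v A (v j)) = A i j"
proof -
  have "e_form v i (matrix_map v A (v j)) = (\<Sum>k<4. A k j * e_form v i (v k))"
    by (simp add: matrix_map_basis[OF assms(1,3)] linear_sum[OF e_form_linear[OF assms(1)]]
        linear_scale[OF e_form_linear[OF assms(1)]])
  also have "\<dots> = (\<Sum>k<4. if k = i then A k j else 0)"
    using e_form_basis[OF assms(1,2)] by (intro sum.cong) auto
  finally show ?thesis using assms(2) by simp
qed

lemma euclid_one:
  assumes "is_basis v"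
  shows "euclid v (mat 1, 0) = id"
proof
  fix x
  \<comment> \<open>In the type \<open>3\<close> the numeral 3 equals 0, so \<open>of_nat\<close>
    separates indices only within 1, 2, 3; index 0 is treated apart by
    \<open>euclid_matrix\<close>.\<close>
  have of_nat_3: "(of_nat i :: 3) = of_nat j \<longleftrightarrow> i = j" if "i \<in> {1, 2, 3}" "j \<in> {1, 2, 3}" for i j
    using that by auto
  have "euclid_matrix (mat 1) 0 i j = (if i = j then 1 else 0)" if "i < 4" "j < 4" for i j
  proof -
    have "i \<in> {0, 1, 2, 3}" "j \<in> {0, 1, 2, 3}" using that by auto
    then show ?thesis using of_nat_3[of i j] by (auto simp: euclid_matrix_def mat_def)
  qed
  then have "(\<Sum>j<4. euclid_matrix (mat 1) 0 i j * e_form v j x)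
      = (\<Sum>j<4. if j = i then e_form v j x else 0)" if "i < 4" for i
    using that by (intro sum.cong) auto
  then show "euclid v (mat 1, 0) x = id x"
    using basis_expansion[OF assms, of x] by (simp add: euclid_def matrix_map_def)
qed

text \<open>A functional on the quotient kills the coset of \<open>v 0\<close>, so its values at the
  cosets of the other three basis vectors determine it. Off the quotient both sides are 0 by
  convention.\<close>

lemma W_expansion:
  assumes "is_basis v" "w \<in> W_space (v 0)"
  shows "w = (\<Sum>i=1..3. w (coset (v 0) (v i)) *\<^sub>R e_bar v i)"
proof
  fix A
  have add: "w (coset (v 0) (x + y)) = w (coset (v 0) x) + w (coset (v 0) y)" for x y
    using assms(2) by (simp add: W_space_def)
  have scale: "w (coset (v 0) (c *\<^sub>R x)) = c * w (coset (v 0) x)" for c x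
    using assms(2) by (simp add: W_space_def)
  show "w A = (\<Sum>i=1..3. w (coset (v 0) (v i)) *\<^sub>R e_bar v i) A"
  proof (cases "A \<in> UNIV // quot_rel (v 0)")
    case True
    then obtain y where y: "A = coset (v 0) y" by (auto simp: coset_def quotient_def)
    have "coset (v 0) (v 0) = coset (v 0) 0"
      unfolding coset_def
      by (rule equiv_class_eq[OF equiv_quot_rel]) (simp add: quot_rel_def span_base)
    then have v0: "w (coset (v 0) (v 0)) = 0" using scale[of 0 0] by simp
    have "y = e_form v 0 y *\<^sub>R v 0 + e_form v 1 y *\<^sub>R v 1 + e_form v 2 y *\<^sub>R v 2 + e_form v 3 y *\<^sub>R v 3"
      using basis_expansion[OF assms(1), of y] by (simp add: eval_nat_numeral)
    then have "w A = w (coset (v 0) (e_form v 0 y *\<^sub>R v 0 + e_form v 1 y *\<^sub>R v 1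
        + e_form v 2 y *\<^sub>R v 2 + e_form v 3 y *\<^sub>R v 3))"
      using y by metis
    also have "\<dots> = (\<Sum>i=1..3. w (coset (v 0) (v i)) * e_form v i y)"
      by (simp only: add scale v0) (simp add: eval_nat_numeral mult.commute)
    finally show ?thesis
      using y e_bar_coset[OF assms(1)] by (simp add: sum_fun_apply)
  next
    case False
    then show ?thesis using assms(2) by (simp add: W_space_def e_bar_def sum_fun_apply)
  qed
qed

text \<open>\<open>linear_between\<close> controls \<open>f\<close> on \<open>X\<close> only, so the
  induction also keeps every partial sum inside \<open>X\<close>.\<close>

lemma linear_between_sum:
  assumes "subspace X" "linear_between X Y f" "\<And>i. i \<in> I \<Longrightarrow> x i \<in> X"
  shows "f (\<Sum>i\<in>I. c i *\<^sub>R x i) = (\<Sum>i\<in>I. c i *\<^sub>R f (x i))"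
proof -
  \<comment> \<open>Settles the empty sum as well as an infinite \<open>I\<close>, over which sums
    are 0 by convention.\<close>
  have "f 0 = 0"
    using assms(2) subspace_0[OF assms(1)] unfolding linear_between_def by (metis scaleR_zero_left)
  then show ?thesis using assms(3)
  proof (induction I rule: infinite_finite_induct)
    case (insert i I)
    have "c i *\<^sub>R x i \<in> X" "(\<Sum>i\<in>I. c i *\<^sub>R x i) \<in> X"
      using insert.prems(2) by (auto intro!: subspace_sum subspace_scale assms(1))
    then show ?case using insert assms(2) by (simp add: linear_between_def)
  qed simp_all
qed

text \<open>Coordinates carry over unchanged, because \<open>e_tilde\<close> is the image of
  \<open>e_bar\<close> under this linear map.\<close>

lemma W_to_T_dual_expansion:
  assumes "is_basis v" "w \<in> W_space (v 0)"
  shows "W_to_T_dual (v 0) w = (\<Sum>i=1..3. w (coset (v 0) (v i)) *\<^sub>R e_tilde v i)"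
  by (subst W_expansion[OF assms], unfold e_tilde_def)
    (rule linear_between_sum[OF subspace_W W_to_T_dual_linear e_bar_in_W[OF assms(1)]])

lemma tensor_sum:
  assumes "subspace X" "subspace Y" "\<And>i. i \<in> I \<Longrightarrow> x i \<in> X" "\<And>j. j \<in> J \<Longrightarrow> y j \<in> Y"
  shows "tensor X Y (\<Sum>i\<in>I. c i *\<^sub>R x i) (\<Sum>j\<in>J. d j *\<^sub>R y j)
    = (\<Sum>i\<in>I. \<Sum>j\<in>J. (c i * d j) *\<^sub>R tensor X Y (x i) (y j))"
proof -
  note bil = tensor_bilinear[OF assms(1,2)]
  have left: "linear_between X UNIV (\<lambda>x. tensor X Y x z)" for z
    by (simp add: linear_between_def bil)
  have right: "linear_between Y UNIV (tensor X Y z)" for z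
    by (simp add: linear_between_def bil)
  show ?thesis
    using linear_between_sum[where I = I and x = x, OF assms(1) left assms(3)]
      linear_between_sum[where I = J and x = y, OF assms(2) right assms(4)]
    by (simp add: scaleR_sum_right mult.commute sum.swap[of _ J I])
qed

lemma linear_euclidean_reduction: "linear (\<lambda>t. euclidean_reduction v t p)"
  unfolding euclidean_reduction_def Let_def
  by (rule linear_compose[OF linear_tensor_map linear_tensor_map, unfolded o_def])

text \<open>Operations on \<open>GL_functions\<close> are pointwise, so evaluation at
  \<open>g\<close> is linear. This makes \<open>tensor_map_tensor\<close> applicable to the outer
  map of the reduction.\<close>

lemma linear_between_eval:
  assumes "g \<in> GL"
  shows "linear_between (GL_functions v0) (dual (T_space v0)) (\<lambda>\<eta>. W_to_T_dual v0 (\<eta> g))"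
  using W_to_T_dual_linear[of v0] assms unfolding linear_between_def GL_functions_def by auto

text \<open>\<open>tensor_map_tensor\<close> applies twice, first to \<open>psi\<close> and then to
  evaluation at \<open>g\<close> and at \<open>id\<close>; both resulting factors are then expanded
  in the \<open>e_tilde\<close> basis.\<close>

lemma euclidean_reduction_tensor:
  fixes v :: "nat \<Rightarrow> 'v::real_vector" and u :: "real^3"
  assumes "is_basis v" "rotation_matrix r" "\<xi> \<in> alt_forms" "\<eta> \<in> alt_forms"
  defines "g \<equiv> euclid v (r, u)"
  shows "euclidean_reduction v (tensor alt_forms alt_forms \<xi> \<eta>) (r, u) =
    (\<Sum>i=1..3. \<Sum>j=1..3. (\<xi> (g (v 0)) (g (v i)) * \<eta> (v 0) (v j)) *\<^sub>R
       tensor (dual (T_space (v 0))) (dual (T_space (v 0))) (e_tilde v i) (e_tilde v j))"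
proof -
  have g: "g \<in> GL" unfolding g_def by (rule euclid_in_GL[OF assms(1,2)])
  have F: "psi (v 0) \<zeta> \<in> GL_functions (v 0)" if "\<zeta> \<in> alt_forms" for \<zeta>
    using psi_linear[of "v 0"] that by (auto simp: linear_between_def)
  have ev: "W_to_T_dual (v 0) (psi (v 0) \<zeta> h)
      = (\<Sum>i=1..3. \<zeta> (h (v 0)) (h (v i)) *\<^sub>R e_tilde v i)"
    if "\<zeta> \<in> alt_forms" "h \<in> GL" for \<zeta> h
  proof -
    have "psi (v 0) \<zeta> h \<in> W_space (v 0)" using F[OF that(1)] that(2) by (simp add: GL_functions_def)
    then show ?thesis by (simp add: W_to_T_dual_expansion[OF assms(1)] psi_coset[OF that])
  qed
  have "euclidean_reduction v (tensor alt_forms alt_forms \<xi> \<eta>) (r, u) =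
    tensor (dual (T_space (v 0))) (dual (T_space (v 0)))
      (W_to_T_dual (v 0) (psi (v 0) \<xi> g)) (W_to_T_dual (v 0) (psi (v 0) \<eta> id))"
    unfolding euclidean_reduction_def Let_def euclid_one[OF assms(1)] g_def[symmetric]
      tensor_map_tensor[OF subspace_alt_forms subspace_alt_forms psi_linear psi_linear assms(3,4)]
    by (rule tensor_map_tensor[OF subspace_GL_functions subspace_GL_functions
          linear_between_eval[OF g] linear_between_eval[OF GL_id] F[OF assms(3)] F[OF assms(4)]])
  also have "\<dots> = (\<Sum>i=1..3. \<Sum>j=1..3. (\<xi> (g (v 0)) (g (v i)) * \<eta> (v 0) (v j)) *\<^sub>R
       tensor (dual (T_space (v 0))) (dual (T_space (v 0))) (e_tilde v i) (e_tilde v j))"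
    unfolding ev[OF assms(3) g] ev[OF assms(4) GL_id] id_apply
    by (rule tensor_sum[OF subspace_dual subspace_dual]) (use e_tilde_independent(3)[OF assms(1)] in blast)+
  finally show ?thesis .
qed

theorem mainTheorem4:
  fixes v :: "nat \<Rightarrow> 'v::real_vector" and r a :: "real^3^3" and u :: "real^3"
  defines "a \<equiv> vector [vector [0, u $ 3, - u $ 2],
                       vector [- u $ 3, 0, u $ 1],
                       vector [u $ 2, - u $ 1, 0]]"
  assumes "is_basis v" and "rotation_matrix r"
  shows "euclidean_reduction v (I2 v) (r, u) =
    (\<Sum>i=1..3. \<Sum>j=1..3. (transpose r ** a) $ of_nat i $ of_nat j *\<^sub>R
       tensor (dual (T_space (v 0))) (dual (T_space (v 0))) (e_tilde v i) (e_tilde v j))"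
proof -
  have ee: "wedge (e_form v k) (e_form v l) \<in> alt_forms" for k l
    by (intro wedge_alt e_form_linear assms(2))
  note red = euclidean_reduction_tensor[OF assms(2,3) ee ee, where u = u]
  note lin = linear_euclidean_reduction[of v "(r, u)"]
  \<comment> \<open>The coordinates of \<open>g (v 0)\<close> are column 0 of the matrix, namely 1
    followed by \<open>u\<close>. For \<open>k\<close>, \<open>l\<close> and \<open>i\<close> all
    positive this is the minor \<open>u_k r_li - u_l r_ki\<close>.\<close>
  have first: "wedge (e_form v k) (e_form v l) (euclid v (r, u) (v 0)) (euclid v (r, u) (v i))
      = euclid_matrix r u k 0 * euclid_matrix r u l i - euclid_matrix r u k i * euclid_matrix r u l 0"
    if "k < 4" "l < 4" "i < 4" for k l i
    using that by (simp add: wedge_def euclid_def e_form_matrix_map[OF assms(2)])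
  \<comment> \<open>For \<open>k < l\<close> and \<open>0 < j\<close> this is nonzero only when
    \<open>k = 0\<close> and \<open>l = j\<close>.\<close>
  have second: "wedge (e_form v k) (e_form v l) (v 0) (v j)
      = (if k = 0 then 1 else 0) * (if l = j then 1 else 0) - (if k = j then 1 else 0) * (if l = 0 then 1 else 0)"
    if "k < 4" "l < 4" "j < 4" for k l j
    using that by (simp add: wedge_def e_form_basis[OF assms(2)])
  show ?thesis
    unfolding I2_def Let_def linear_add[OF lin] linear_diff[OF lin] red
      sum.distrib[symmetric] sum_subtractf[symmetric]
      scaleR_add_left[symmetric] scaleR_diff_left[symmetric]
  proof (intro sum.cong refl arg_cong2[where f = scaleR])
    fix i j :: nat
    assume "i \<in> {1..3}" "j \<in> {1..3}"
    \<comment> \<open>The cases on \<open>j\<close> select the surviving term of \<open>I2\<close>.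
      The index \<open>i\<close> stays generic: \<open>0 < i\<close> makes the top entry of column
      \<open>i\<close> vanish and the others come from \<open>r\<close>.\<close>
    then have "0 < i" "i < 4" "j = 1 \<or> j = 2 \<or> j = 3" by auto
    then show "wedge (e_form v 0) (e_form v 1) (euclid v (r, u) (v 0)) (euclid v (r, u) (v i))
          * wedge (e_form v 2) (e_form v 3) (v 0) (v j)
        + wedge (e_form v 2) (e_form v 3) (euclid v (r, u) (v 0)) (euclid v (r, u) (v i))
          * wedge (e_form v 0) (e_form v 1) (v 0) (v j)
        - wedge (e_form v 0) (e_form v 2) (euclid v (r, u) (v 0)) (euclid v (r, u) (v i))
          * wedge (e_form v 1) (e_form v 3) (v 0) (v j)
        - wedge (e_form v 1) (e_form v 3) (euclid v (r, u) (v 0)) (euclid v (r, u) (v i))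
          * wedge (e_form v 0) (e_form v 2) (v 0) (v j)
        + wedge (e_form v 0) (e_form v 3) (euclid v (r, u) (v 0)) (euclid v (r, u) (v i))
          * wedge (e_form v 1) (e_form v 2) (v 0) (v j)
        + wedge (e_form v 1) (e_form v 2) (euclid v (r, u) (v 0)) (euclid v (r, u) (v i))
          * wedge (e_form v 0) (e_form v 3) (v 0) (v j)
        = (transpose r ** a) $ of_nat i $ of_nat j"
      by (auto simp: first second euclid_matrix_def a_def matrix_matrix_mult_def transpose_def
          sum_3 vector_3 algebra_simps)
  qed
qed

end
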